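(* Let $N\ge2$, $M\ge2$ and $Q$ be integers with $1\le Q\le M-1$, write $\mathcal{M}=\{1,\dots,M\}$, let $0<\epsilon<1$, and let $\mathbf{H}_1,\dots,\mathbf{H}_M$ be $N\times N$ complex Hermitian positive semidefinite matrices. Let $v^{\max}_{\rm QP}$ be the optimal value of (P2): maximize $\|\mathbf{w}\|^2$ over $\mathbf{w}\in\mathbb{C}^N$, $\boldsymbol\beta\in\{0,1\}^M$ subject to $\mathbf{w}^H\mathbf{H}_i\mathbf{w}\le\beta_i\epsilon+(1-\beta_i)$ ($i\in\mathcal{M}$) and $\sum_i\beta_i=Q$; and let $v^{\max}_{\rm SDP}$ be the optimal value of (SDP3): maximize $\mathrm{Tr}[\mathbf{X}]$ over Hermitian $N\times N$ matrices $\mathbf{X}\succeq0$ and $\boldsymbol\beta\in\mathbb{R}^M$ subject to $\mathrm{Tr}[\mathbf{H}_i\mathbf{X}]\le\beta_i\epsilon+(1-\beta_i)$ ($i\in\mathcal{M}$), $\sum_i\beta_i=Q$, $0\le\beta_i\le1$. Then $$v^{\max}_{\rm QP}\ge\frac{\epsilon}{\tilde c(\epsilon)}\cdot\frac{1}{4\ln(100K)}\,v^{\max}_{\rm SDP},$$ where $K=\sum_{i=1}^M\min\{\mathrm{rank}(\mathbf{H}_i),\sqrt{M}\}$ and $\tilde c(\epsilon)=1-\frac{1-\epsilon}{M-Q+1}$.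
   Context: ${}^H$ denotes conjugate transpose. *)

theory Defs
  imports "HOL-Analysis.Analysis"
begin

text \<open>Complex N x N matrices are represented as complex^'n^'n with N = CARD('n).\<close>

definition cmat_adj :: "complex^'n^'n \<Rightarrow> complex^'n^'n" where
  "cmat_adj X = (\<chi> i j. cnj (X $ j $ i))"

definition hermitian_mat :: "complex^'n^'n \<Rightarrow> bool" where
  "hermitian_mat X \<longleftrightarrow> cmat_adj X = X"

text \<open>Quadratic form w^H X w.\<close>
definition qform :: "complex^'n^'n \<Rightarrow> complex^'n \<Rightarrow> complex" where
  "qform X w = (\<Sum>i\<in>UNIV. cnj (w $ i) * (X *v w) $ i)"

definition psd_mat :: "complex^'n^'n \<Rightarrow> bool" where
  "psd_mat X \<longleftrightarrow> hermitian_mat X \<and> (\<forall>w. Im (qform X w) = 0 \<and> 0 \<le> Re (qform X w))"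

definition ctrace :: "complex^'n^'n \<Rightarrow> complex" where
  "ctrace X = (\<Sum>i\<in>UNIV. X $ i $ i)"

text \<open>Optimal value of (P2), as an extended real (supremum over the feasible set).\<close>
definition v_QP :: "nat \<Rightarrow> nat \<Rightarrow> real \<Rightarrow> (nat \<Rightarrow> complex^'n^'n) \<Rightarrow> ereal" where
  "v_QP M Q \<epsilon> H = (SUP p \<in> {(w :: complex^'n, \<beta> :: nat \<Rightarrow> real).
        (\<forall>i\<in>{1..M}. \<beta> i \<in> {0, 1}) \<and>
        (\<forall>i\<in>{1..M}. Re (qform (H i) w) \<le> \<beta> i * \<epsilon> + (1 - \<beta> i)) \<and>
        (\<Sum>i=1..M. \<beta> i) = real Q}.
      ereal ((norm (fst p))\<^sup>2))"

text \<open>Optimal value of (SDP3), as an extended real.\<close>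
definition v_SDP :: "nat \<Rightarrow> nat \<Rightarrow> real \<Rightarrow> (nat \<Rightarrow> complex^'n^'n) \<Rightarrow> ereal" where
  "v_SDP M Q \<epsilon> H = (SUP p \<in> {(X :: complex^'n^'n, \<beta> :: nat \<Rightarrow> real).
        psd_mat X \<and>
        (\<forall>i\<in>{1..M}. Re (ctrace (H i ** X)) \<le> \<beta> i * \<epsilon> + (1 - \<beta> i)) \<and>
        (\<Sum>i=1..M. \<beta> i) = real Q \<and>
        (\<forall>i\<in>{1..M}. 0 \<le> \<beta> i \<and> \<beta> i \<le> 1)}.
      ereal (Re (ctrace (fst p))))"

end

theory Submission
  imports Defs "HOL-Probability.Hoeffding"
begin

text \<open>
  Write an SDP solution as \<open>X = \<Sum>\<^sub>j f\<^sub>j f\<^sub>j\<^sup>H\<close> with orthogonal \<open>f\<^sub>j\<close> (split off a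
  top eigenvector and recurse) and consider the sign combinations \<open>w = \<Sum>\<^sub>j s\<^sub>j f\<^sub>j\<close>,
  \<open>s \<in> {-1, 1}\<^sup>m\<close>. Each of them has \<open>norm w ^ 2 = Tr X\<close>, while \<open>w\<^sup>H H w\<close> is a sum of
  squared moduli of Rademacher sums whose mean is \<open>Tr (H X)\<close>. Hoeffding's lemma, a layer-cake
  summation and Jensen's inequality show that at most a fraction \<open>28 exp (- t / 4)\<close> of the
  \<open>2 ^ m\<close> sign vectors give \<open>w\<^sup>H H w > t Tr (H X)\<close>; with \<open>t = 4 ln (100 K)\<close> a union bound
  over the at most \<open>K\<close> nonzero \<open>H\<^sub>i\<close> leaves a sign vector that is good for every constraint.
  Finally at least \<open>Q\<close> of the relaxed \<open>\<beta>\<^sub>i\<close> are at least \<open>1 / (M - Q + 1)\<close>; for those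
  \<open>Tr (H\<^sub>i X) \<le> c\<^sup>~(\<epsilon>)\<close>, for the others \<open>Tr (H\<^sub>i X) \<le> 1\<close>, so \<open>w\<close> scaled by
  \<open>sqrt (\<epsilon> / (c\<^sup>~(\<epsilon>) t))\<close> is feasible for (P2).
\<close>

section \<open>Rademacher sums\<close>

lemma cosh_le_exp_half_square: "cosh (a::real) \<le> exp (a\<^sup>2 / 2)"
proof -
  have "cosh b \<le> exp (b\<^sup>2 / 2)" if "b \<ge> 0" for b :: real
  proof -
    \<comment> \<open>Hoeffding's lemma for a centred variable with values \<open>\<plusminus>b\<close>\<close>
    have "- (2 * b) * (1/2) + ln (1 + (1/2) * (exp (2 * b) - 1)) \<le> (2 * b)\<^sup>2 / 8"
      using Hoeffdings_lemma_aux[of "2 * b" "1/2"] that by simp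
    hence "ln ((1 + exp (2 * b)) / 2) \<le> b + b\<^sup>2 / 2"
      by (simp add: power2_eq_square field_simps)
    hence "(1 + exp (2 * b)) / 2 \<le> exp (b + b\<^sup>2 / 2)"
      by (smt (verit) exp_gt_zero exp_le_cancel_iff exp_ln)
    hence "(1 + exp (2 * b)) / 2 * exp (- b) \<le> exp (b + b\<^sup>2 / 2) * exp (- b)"
      by (intro mult_right_mono) auto
    thus ?thesis
      by (simp add: cosh_field_def field_simps flip: exp_add)
  qed
  from this[of "\<bar>a\<bar>"] show ?thesis
    by (cases "a \<ge> 0") auto
qed

definition sign_vectors :: "nat \<Rightarrow> (nat \<Rightarrow> real) set" where
  "sign_vectors m = PiE {..<m} (\<lambda>_. {-1, 1})"

lemma finite_sign_vectors [simp]: "finite (sign_vectors m)"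
  unfolding sign_vectors_def by (intro finite_PiE) auto

lemma card_sign_vectors: "card (sign_vectors m) = 2 ^ m"
proof -
  have "card {-1, 1::real} = 2"
    by simp
  thus ?thesis
    unfolding sign_vectors_def by (simp add: card_PiE del: insert_iff)
qed

lemma sign_vectors_square: "s \<in> sign_vectors m \<Longrightarrow> j < m \<Longrightarrow> (s j)\<^sup>2 = 1"
  unfolding sign_vectors_def by (auto simp: PiE_def Pi_def)

lemma sum_sign_vectors_exp_le:
  "(\<Sum>s\<in>sign_vectors m. exp (\<Sum>j<m. a j * s j)) \<le> 2 ^ m * exp ((\<Sum>j<m. (a j)\<^sup>2) / 2)"
proof -
  have "(\<Sum>s\<in>sign_vectors m. exp (\<Sum>j<m. a j * s j))
      = (\<Sum>s\<in>sign_vectors m. \<Prod>j<m. exp (a j * s j))"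
    by (simp add: exp_sum)
  also have "\<dots> = (\<Prod>j<m. \<Sum>y\<in>{-1, 1::real}. exp (a j * y))"
    unfolding sign_vectors_def by (rule prod_sum_PiE[symmetric]) auto
  also have "\<dots> = (\<Prod>j<m. 2 * cosh (a j))"
    by (intro prod.cong) (auto simp: cosh_field_def)
  also have "\<dots> \<le> (\<Prod>j<m. 2 * exp ((a j)\<^sup>2 / 2))"
    by (intro prod_mono conjI) (auto intro: cosh_le_exp_half_square)
  also have "\<dots> = 2 ^ m * exp ((\<Sum>j<m. (a j)\<^sup>2) / 2)"
    by (simp add: prod.distrib exp_sum sum_divide_distrib)
  finally show ?thesis .
qed

lemma card_rademacher_tail_le:
  assumes "y \<ge> 0" and "(\<Sum>j<m. (a j)\<^sup>2) > 0"
  shows "real (card {s\<in>sign_vectors m. y \<le> (\<Sum>j<m. a j * s j)})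
           \<le> 2 ^ m * exp (- y\<^sup>2 / (2 * (\<Sum>j<m. (a j)\<^sup>2)))"
proof -
  define v where "v = (\<Sum>j<m. (a j)\<^sup>2)"
  define \<theta> where "\<theta> = y / v"
  have v: "v > 0" and \<theta>: "\<theta> \<ge> 0"
    using assms by (auto simp: v_def \<theta>_def)
  define A where "A = {s\<in>sign_vectors m. y \<le> (\<Sum>j<m. a j * s j)}"
  have "real (card A) = (\<Sum>s\<in>A. 1)"
    by simp
  also have "\<dots> \<le> (\<Sum>s\<in>A. exp (\<theta> * (\<Sum>j<m. a j * s j) - \<theta> * y))"
    by (intro sum_mono) (auto intro!: mult_left_mono \<theta> simp: A_def)
  also have "\<dots> \<le> (\<Sum>s\<in>sign_vectors m. exp (\<theta> * (\<Sum>j<m. a j * s j) - \<theta> * y))"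
    by (intro sum_mono2) (auto simp: A_def)
  also have "\<dots> = exp (- \<theta> * y) * (\<Sum>s\<in>sign_vectors m. exp (\<Sum>j<m. (\<theta> * a j) * s j))"
    by (simp add: sum_distrib_left sum_distrib_right mult.assoc flip: exp_add)
  also have "\<dots> \<le> exp (- \<theta> * y) * (2 ^ m * exp ((\<Sum>j<m. (\<theta> * a j)\<^sup>2) / 2))"
    by (intro mult_left_mono sum_sign_vectors_exp_le) auto
  also have "(\<Sum>j<m. (\<theta> * a j)\<^sup>2) = \<theta>\<^sup>2 * v"
    by (simp add: v_def power_mult_distrib sum_distrib_left)
  also have "exp (- \<theta> * y) * (2 ^ m * exp (\<theta>\<^sup>2 * v / 2)) = 2 ^ m * exp (- y\<^sup>2 / (2 * v))"
    using v by (simp add: \<theta>_def power2_eq_square field_simps flip: exp_add)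
  finally show ?thesis
    by (simp add: A_def v_def)
qed

lemma card_rademacher_abs_tail_le:
  assumes "y \<ge> 0" and "(\<Sum>j<m. (a j)\<^sup>2) > 0"
  shows "real (card {s\<in>sign_vectors m. y \<le> \<bar>\<Sum>j<m. a j * s j\<bar>})
           \<le> 2 * 2 ^ m * exp (- y\<^sup>2 / (2 * (\<Sum>j<m. (a j)\<^sup>2)))"
proof -
  have neg: "(\<Sum>j<m. - a j * s j) = - (\<Sum>j<m. a j * s j)" for s
    by (simp add: sum_negf)
  have "{s\<in>sign_vectors m. y \<le> \<bar>\<Sum>j<m. a j * s j\<bar>}
      \<subseteq> {s\<in>sign_vectors m. y \<le> (\<Sum>j<m. a j * s j)} \<union> {s\<in>sign_vectors m. y \<le> (\<Sum>j<m. - a j * s j)}"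
    unfolding neg by (auto simp del: sum_negf)
  hence "card {s\<in>sign_vectors m. y \<le> \<bar>\<Sum>j<m. a j * s j\<bar>}
      \<le> card {s\<in>sign_vectors m. y \<le> (\<Sum>j<m. a j * s j)} + card {s\<in>sign_vectors m. y \<le> (\<Sum>j<m. - a j * s j)}"
    by (intro order_trans[OF card_mono card_Un_le]) auto
  moreover have "real (card {s\<in>sign_vectors m. y \<le> (\<Sum>j<m. - a j * s j)})
      \<le> 2 ^ m * exp (- y\<^sup>2 / (2 * (\<Sum>j<m. (a j)\<^sup>2)))"
    using card_rademacher_tail_le[where a="\<lambda>j. - a j"] assms by simp
  ultimately show ?thesis
    using card_rademacher_tail_le[OF assms] by linarith
qed

lemma card_rademacher_square_tail_le:
  assumes "x \<ge> 0"
  shows "real (card {s\<in>sign_vectors m. (\<Sum>j<m. (a j)\<^sup>2) * x < (\<Sum>j<m. a j * s j)\<^sup>2})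
           \<le> 2 * 2 ^ m * exp (- x / 2)"
proof (cases "(\<Sum>j<m. (a j)\<^sup>2) > 0")
  case False
  hence "(\<Sum>j<m. (a j)\<^sup>2) = 0"
    by (simp add: not_less order_antisym sum_nonneg)
  hence "\<forall>j<m. a j = 0"
    by (subst (asm) sum_nonneg_eq_0_iff) auto
  thus ?thesis
    by simp
next
  case v: True
  define y where "y = sqrt ((\<Sum>j<m. (a j)\<^sup>2) * x)"
  have y: "y \<ge> 0" "y\<^sup>2 = (\<Sum>j<m. (a j)\<^sup>2) * x"
    using v assms by (auto simp: y_def)
  have "y \<le> \<bar>\<Sum>j<m. a j * s j\<bar>" if "(\<Sum>j<m. (a j)\<^sup>2) * x < (\<Sum>j<m. a j * s j)\<^sup>2" for s
  proof -
    have "y\<^sup>2 < \<bar>\<Sum>j<m. a j * s j\<bar>\<^sup>2"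
      using that y(2) by simp
    hence "y < \<bar>\<Sum>j<m. a j * s j\<bar>"
      by (rule power_less_imp_less_base) simp
    thus ?thesis
      by simp
  qed
  hence "real (card {s\<in>sign_vectors m. (\<Sum>j<m. (a j)\<^sup>2) * x < (\<Sum>j<m. a j * s j)\<^sup>2})
      \<le> real (card {s\<in>sign_vectors m. y \<le> \<bar>\<Sum>j<m. a j * s j\<bar>})"
    by (intro of_nat_mono card_mono) auto
  also have "\<dots> \<le> 2 * 2 ^ m * exp (- y\<^sup>2 / (2 * (\<Sum>j<m. (a j)\<^sup>2)))"
    by (rule card_rademacher_abs_tail_le[OF y(1) v])
  also have "- y\<^sup>2 / (2 * (\<Sum>j<m. (a j)\<^sup>2)) = - x / 2"
    using y(2) v by (simp add: field_simps)
  finally show ?thesis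
    by simp
qed

lemma sum_mult_eq_0_if_sum_cmod_square_eq_0:
  fixes c :: "nat \<Rightarrow> complex"
  assumes "(\<Sum>j<m. (cmod (c j))\<^sup>2) = 0"
  shows "(\<Sum>j<m. f j * c j) = 0"
proof -
  have "\<forall>j\<in>{..<m}. (cmod (c j))\<^sup>2 = 0"
    using assms by (subst (asm) sum_nonneg_eq_0_iff) auto
  thus ?thesis
    by simp
qed

lemma card_complex_rademacher_tail_le:
  fixes c :: "nat \<Rightarrow> complex"
  assumes "x \<ge> 0"
  shows "real (card {s\<in>sign_vectors m.
            (\<Sum>j<m. (cmod (c j))\<^sup>2) * x < (cmod (\<Sum>j<m. of_real (s j) * c j))\<^sup>2})
           \<le> 4 * 2 ^ m * exp (- x / 2)"
proof -
  define p where "p = (\<Sum>j<m. (Re (c j))\<^sup>2)"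
  define q where "q = (\<Sum>j<m. (Im (c j))\<^sup>2)"
  define A where "A = {s\<in>sign_vectors m. p * x < (\<Sum>j<m. Re (c j) * s j)\<^sup>2}"
  define B where "B = {s\<in>sign_vectors m. q * x < (\<Sum>j<m. Im (c j) * s j)\<^sup>2}"
  have "(\<Sum>j<m. (cmod (c j))\<^sup>2) = p + q"
    by (simp add: p_def q_def cmod_power2 sum.distrib)
  moreover have "(cmod (\<Sum>j<m. of_real (s j) * c j))\<^sup>2
      = (\<Sum>j<m. Re (c j) * s j)\<^sup>2 + (\<Sum>j<m. Im (c j) * s j)\<^sup>2" for s
    by (simp add: cmod_power2 Re_sum Im_sum mult.commute)
  ultimately have "{s\<in>sign_vectors m. (\<Sum>j<m. (cmod (c j))\<^sup>2) * x < (cmod (\<Sum>j<m. of_real (s j) * c j))\<^sup>2}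
      \<subseteq> A \<union> B"
    by (auto simp: A_def B_def distrib_right)
  hence "card {s\<in>sign_vectors m. (\<Sum>j<m. (cmod (c j))\<^sup>2) * x < (cmod (\<Sum>j<m. of_real (s j) * c j))\<^sup>2}
      \<le> card A + card B"
    by (intro order_trans[OF card_mono card_Un_le]) (auto simp: A_def B_def)
  moreover have "real (card A) \<le> 2 * 2 ^ m * exp (- x / 2)" "real (card B) \<le> 2 * 2 ^ m * exp (- x / 2)"
    unfolding A_def B_def p_def q_def by (rule card_rademacher_square_tail_le[OF assms])+
  ultimately show ?thesis
    by linarith
qed

lemma exp_le_one_plus_layer_sum:
  fixes z :: real
  assumes "0 \<le> z" "z \<le> real B"
  shows "exp (z / 4) \<le> 1 + (\<Sum>k\<le>B. if real k < z then exp ((real k + 1) / 4) else 0)"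
proof (cases "z = 0")
  case False
  define k where "k = nat \<lceil>z\<rceil> - 1"
  have k: "real k < z" "z \<le> real k + 1" "k \<le> B"
    using assms False by (auto simp: k_def of_nat_diff) linarith+
  have "exp (z / 4) \<le> (if real k < z then exp ((real k + 1) / 4) else 0)"
    using k by simp
  also have "\<dots> \<le> (\<Sum>k\<le>B. if real k < z then exp ((real k + 1) / 4) else 0)"
    using k by (intro member_le_sum) auto
  finally show ?thesis
    by simp
qed (auto intro: sum_nonneg)

lemma exp_quarter_le: "exp (1/4 :: real) \<le> 4/3"
proof (rule ccontr)
  assume "\<not> ?thesis"
  hence "(4/3 :: real) ^ 4 < exp (1/4) ^ 4"
    by (intro power_strict_mono) auto
  also have "exp (1/4 :: real) ^ 4 = exp 1"
    by (simp flip: exp_of_nat_mult)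
  finally show False
    using exp_le by (simp add: power4_eq_xxxx)
qed

lemma sum_exp_minus_quarter_le: "(\<Sum>k\<le>B. exp (- real k / 4)) \<le> (5 :: real)"
proof -
  define r where "r = exp (- 1/4 :: real)"
  have "1 + 1/4 \<le> exp (1/4 :: real)"
    by (rule exp_ge_add_one_self)
  hence r: "0 < r" "r \<le> 4/5"
    by (auto simp: r_def exp_minus field_simps)
  have "(\<Sum>k\<le>B. exp (- real k / 4)) = (\<Sum>k<Suc B. r ^ k)"
    by (intro sum.cong) (auto simp: r_def lessThan_Suc_atMost simp flip: exp_of_nat_mult)
  also have "\<dots> = (1 - r ^ Suc B) / (1 - r)"
    using r by (subst sum_gp_strict) auto
  also have "\<dots> \<le> 1 / (1 - r)"
    using r by (intro divide_right_mono) auto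
  also have "\<dots> \<le> 5"
    using r by (simp add: field_simps)
  finally show ?thesis .
qed

lemma sum_exp_quarter_le_of_tail:
  fixes Z :: "'a \<Rightarrow> real"
  assumes "finite A" and Z: "\<And>s. s \<in> A \<Longrightarrow> 0 \<le> Z s" and "0 \<le> C"
    and tail: "\<And>k :: nat. real (card {s\<in>A. real k < Z s}) \<le> C * exp (- real k / 2)"
  shows "(\<Sum>s\<in>A. exp (Z s / 4)) \<le> real (card A) + 20 / 3 * C"
proof -
  define B where "B = nat \<lceil>Max (insert 0 (Z ` A))\<rceil>"
  have "Z s \<le> real B" if "s \<in> A" for s
  proof -
    have "Z s \<le> Max (insert 0 (Z ` A))"
      using that \<open>finite A\<close> by (intro Max_ge) auto
    thus ?thesis
      unfolding B_def by linarith
  qed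
  hence "(\<Sum>s\<in>A. exp (Z s / 4))
      \<le> (\<Sum>s\<in>A. 1 + (\<Sum>k\<le>B. if real k < Z s then exp ((real k + 1) / 4) else 0))"
    using Z by (intro sum_mono exp_le_one_plus_layer_sum) auto
  also have "\<dots> = card A + (\<Sum>k\<le>B. \<Sum>s\<in>A. if real k < Z s then exp ((real k + 1) / 4) else 0)"
    by (simp add: sum.distrib sum.swap[of _ A])
  also have "\<dots> = card A + (\<Sum>k\<le>B. exp ((real k + 1) / 4) * card {s\<in>A. real k < Z s})"
    using \<open>finite A\<close> by (simp add: sum.If_cases Int_def conj_commute mult.commute)
  also have "\<dots> \<le> card A + (\<Sum>k\<le>B. exp ((real k + 1) / 4) * (C * exp (- real k / 2)))"
    using tail by (intro add_left_mono sum_mono mult_left_mono) auto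
  also have "(\<Sum>k\<le>B. exp ((real k + 1) / 4) * (C * exp (- real k / 2)))
      = C * exp (1/4) * (\<Sum>k\<le>B. exp (- real k / 4))"
  proof -
    have "exp ((real k + 1) / 4) * exp (- real k / 2) = exp (1/4) * exp (- real k / 4)" for k
      by (simp flip: exp_add) (simp add: field_simps)
    thus ?thesis
      by (simp add: sum_distrib_left mult_ac)
  qed
  also have "\<dots> \<le> C * (4/3) * 5"
    using exp_quarter_le sum_exp_minus_quarter_le \<open>0 \<le> C\<close>
    by (intro mult_mono) (auto intro: sum_nonneg)
  finally show ?thesis
    by simp
qed

text \<open>No hypothesis on \<open>c\<close> is needed: for \<open>c = 0\<close> every exponent divides by zero and is therefore \<open>0\<close>.\<close>

lemma sum_exp_complex_rademacher_le:
  fixes c :: "nat \<Rightarrow> complex"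
  shows "(\<Sum>s\<in>sign_vectors m.
            exp ((cmod (\<Sum>j<m. of_real (s j) * c j))\<^sup>2 / (\<Sum>j<m. (cmod (c j))\<^sup>2) / 4))
           \<le> 28 * 2 ^ m"
proof -
  define \<rho> where "\<rho> = (\<Sum>j<m. (cmod (c j))\<^sup>2)"
  have \<rho>: "0 \<le> \<rho>"
    by (simp add: \<rho>_def sum_nonneg)
  define Z where "Z s = (cmod (\<Sum>j<m. of_real (s j) * c j))\<^sup>2 / \<rho>" for s
  have tail: "real (card {s\<in>sign_vectors m. real k < Z s}) \<le> 4 * 2 ^ m * exp (- real k / 2)" for k
  proof -
    have "card {s\<in>sign_vectors m. real k < Z s}
        \<le> card {s\<in>sign_vectors m. \<rho> * real k < (cmod (\<Sum>j<m. of_real (s j) * c j))\<^sup>2}"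
      using \<rho> by (intro card_mono) (auto simp: Z_def less_divide_eq mult.commute split: if_splits)
    hence "real (card {s\<in>sign_vectors m. real k < Z s})
        \<le> real (card {s\<in>sign_vectors m. \<rho> * real k < (cmod (\<Sum>j<m. of_real (s j) * c j))\<^sup>2})"
      by simp
    also have "\<dots> \<le> 4 * 2 ^ m * exp (- real k / 2)"
      unfolding \<rho>_def by (rule card_complex_rademacher_tail_le) simp
    finally show ?thesis .
  qed
  have "(\<Sum>s\<in>sign_vectors m. exp (Z s / 4)) \<le> real (card (sign_vectors m)) + 20 / 3 * (4 * 2 ^ m)"
    by (rule sum_exp_quarter_le_of_tail[OF finite_sign_vectors _ _ tail]) (use \<rho> in \<open>simp_all add: Z_def\<close>)
  also have "\<dots> \<le> 28 * 2 ^ m"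
    by (simp add: card_sign_vectors)
  finally show ?thesis
    by (simp add: Z_def \<rho>_def)
qed

lemma sum_exp_sum_complex_rademacher_le:
  fixes c :: "nat \<Rightarrow> nat \<Rightarrow> complex"
  shows "(\<Sum>s\<in>sign_vectors m. exp ((\<Sum>l<n. (cmod (\<Sum>j<m. of_real (s j) * c l j))\<^sup>2)
            / (\<Sum>l<n. \<Sum>j<m. (cmod (c l j))\<^sup>2) / 4)) \<le> 28 * 2 ^ m"
proof -
  define \<rho> where "\<rho> l = (\<Sum>j<m. (cmod (c l j))\<^sup>2)" for l
  define \<tau> where "\<tau> = (\<Sum>l<n. \<rho> l)"
  define z where "z l s = (cmod (\<Sum>j<m. of_real (s j) * c l j))\<^sup>2 / \<rho> l" for l s
  have \<rho>: "0 \<le> \<rho> l" for l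
    by (simp add: \<rho>_def sum_nonneg)
  have "0 \<le> \<tau>"
    using \<rho> by (simp add: \<tau>_def sum_nonneg)
  \<comment> \<open>Jensen for the weights \<open>\<rho> l / \<tau>\<close> reduces to one row at a time\<close>
  have jensen: "exp ((\<Sum>l<n. (cmod (\<Sum>j<m. of_real (s j) * c l j))\<^sup>2) / \<tau> / 4)
      \<le> (\<Sum>l<n. \<rho> l / \<tau> * exp (z l s / 4))" if "0 < \<tau>" for s
  proof -
    have "(\<rho> l / \<tau>) *\<^sub>R (z l s / 4) = (cmod (\<Sum>j<m. of_real (s j) * c l j))\<^sup>2 / \<tau> / 4" for l
      by (cases "\<rho> l = 0") (simp_all add: z_def \<rho>_def sum_mult_eq_0_if_sum_cmod_square_eq_0)
    hence "(\<Sum>l<n. (cmod (\<Sum>j<m. of_real (s j) * c l j))\<^sup>2) / \<tau> / 4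
        = (\<Sum>l<n. (\<rho> l / \<tau>) *\<^sub>R (z l s / 4))"
      by (simp only: sum_divide_distrib)
    moreover have "{..<n} \<noteq> {}"
      using that by (auto simp: \<tau>_def)
    ultimately show ?thesis
      using convex_on_sum[OF finite_lessThan _ exp_convex, of n "\<lambda>l. \<rho> l / \<tau>" "\<lambda>l. z l s / 4"] that \<rho>
      by (simp add: \<tau>_def sum_divide_distrib[symmetric])
  qed
  show ?thesis
  proof (cases "\<tau> = 0")
    case True
    thus ?thesis
      by (simp add: \<tau>_def \<rho>_def card_sign_vectors)
  next
    case False
    hence \<tau>: "0 < \<tau>"
      using \<open>0 \<le> \<tau>\<close> by simp
    have "(\<Sum>s\<in>sign_vectors m. exp ((\<Sum>l<n. (cmod (\<Sum>j<m. of_real (s j) * c l j))\<^sup>2) / \<tau> / 4))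
        \<le> (\<Sum>s\<in>sign_vectors m. \<Sum>l<n. \<rho> l / \<tau> * exp (z l s / 4))"
      using jensen[OF \<tau>] by (intro sum_mono) auto
    also have "\<dots> = (\<Sum>l<n. \<rho> l / \<tau> * (\<Sum>s\<in>sign_vectors m. exp (z l s / 4)))"
      by (simp add: sum.swap[of _ "sign_vectors m"] sum_distrib_left)
    also have "\<dots> \<le> (\<Sum>l<n. \<rho> l / \<tau> * (28 * 2 ^ m))"
      using sum_exp_complex_rademacher_le \<tau> \<rho>
      by (intro sum_mono mult_left_mono) (auto simp: z_def \<rho>_def)
    also have "\<dots> = 28 * 2 ^ m"
      using \<tau> by (simp add: \<tau>_def sum_distrib_right[symmetric] sum_divide_distrib[symmetric])
    finally show ?thesis
      by (simp add: \<tau>_def \<rho>_def)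
  qed
qed

lemma card_sum_complex_rademacher_tail_le:
  fixes c :: "nat \<Rightarrow> nat \<Rightarrow> complex"
  shows "real (card {s\<in>sign_vectors m. t * (\<Sum>l<n. \<Sum>j<m. (cmod (c l j))\<^sup>2)
            < (\<Sum>l<n. (cmod (\<Sum>j<m. of_real (s j) * c l j))\<^sup>2)})
           \<le> 28 * 2 ^ m * exp (- t / 4)"
proof -
  define \<tau> where "\<tau> = (\<Sum>l<n. \<Sum>j<m. (cmod (c l j))\<^sup>2)"
  define Y where "Y s = (\<Sum>l<n. (cmod (\<Sum>j<m. of_real (s j) * c l j))\<^sup>2)" for s
  define A where "A = {s\<in>sign_vectors m. t * \<tau> < Y s}"
  have "0 \<le> \<tau>"
    by (simp add: \<tau>_def sum_nonneg)
  show ?thesis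
  proof (cases "\<tau> = 0")
    case True
    hence "\<forall>l\<in>{..<n}. (\<Sum>j<m. (cmod (c l j))\<^sup>2) = 0"
      by (subst (asm) \<tau>_def, subst (asm) sum_nonneg_eq_0_iff) (auto intro: sum_nonneg)
    hence "Y s = 0" for s
      by (simp add: Y_def sum_mult_eq_0_if_sum_cmod_square_eq_0)
    thus ?thesis
      using True by (simp add: Y_def \<tau>_def)
  next
    case False
    hence \<tau>: "0 < \<tau>"
      using \<open>0 \<le> \<tau>\<close> by simp
    have "real (card A) = (\<Sum>s\<in>A. 1)"
      by simp
    also have "\<dots> \<le> (\<Sum>s\<in>A. exp (Y s / \<tau> / 4 - t / 4))"
      using \<tau> by (intro sum_mono) (auto simp: A_def field_simps)
    also have "\<dots> \<le> (\<Sum>s\<in>sign_vectors m. exp (Y s / \<tau> / 4 - t / 4))"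
      by (intro sum_mono2) (auto simp: A_def)
    also have "\<dots> = exp (- t / 4) * (\<Sum>s\<in>sign_vectors m. exp (Y s / \<tau> / 4))"
      by (simp add: sum_distrib_left flip: exp_add)
    also have "\<dots> \<le> exp (- t / 4) * (28 * 2 ^ m)"
      using sum_exp_sum_complex_rademacher_le[where m=m and n=n and c=c]
      by (intro mult_left_mono) (auto simp: Y_def \<tau>_def)
    finally show ?thesis
      by (simp add: A_def Y_def \<tau>_def mult.commute)
  qed
qed

section \<open>Hermitian and positive semidefinite matrices\<close>

definition cinner :: "complex^'n \<Rightarrow> complex^'n \<Rightarrow> complex" where
  "cinner a b = (\<Sum>k\<in>UNIV. cnj (a $ k) * b $ k)"

definition outer_prod :: "complex^'n \<Rightarrow> complex^'n^'n" where
  "outer_prod f = (\<chi> i j. f $ i * cnj (f $ j))"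

lemma qform_eq_cinner: "qform X w = cinner w (X *v w)"
  by (simp add: qform_def cinner_def)

lemma cinner_add_left: "cinner (a + b) c = cinner a c + cinner b c"
  by (simp add: cinner_def sum.distrib algebra_simps)

lemma cinner_add_right: "cinner a (b + c) = cinner a b + cinner a c"
  by (simp add: cinner_def sum.distrib algebra_simps)

lemma cinner_diff_right: "cinner a (b - c) = cinner a b - cinner a c"
  by (simp add: cinner_def sum_subtractf algebra_simps)

lemma cinner_smult_left: "cinner (r *s a) b = cnj r * cinner a b"
  by (simp add: cinner_def sum_distrib_left algebra_simps)

lemma cinner_smult_right: "cinner a (r *s b) = r * cinner a b"
  by (simp add: cinner_def sum_distrib_left algebra_simps)

lemma cinner_zero_left [simp]: "cinner 0 b = 0"
  by (simp add: cinner_def)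

lemma cinner_commute: "cinner b a = cnj (cinner a b)"
  by (simp add: cinner_def mult.commute)

lemma cinner_sum_right: "cinner a (\<Sum>j\<in>S. F j) = (\<Sum>j\<in>S. cinner a (F j))"
  by (simp add: cinner_def sum_distrib_left sum_component) (rule sum.swap)

lemma norm_vec_square: "(norm (x :: complex^'n))\<^sup>2 = (\<Sum>i\<in>UNIV. (cmod (x $ i))\<^sup>2)"
  by (simp add: norm_vec_def L2_set_def sum_nonneg)

lemma cinner_self: "cinner a a = of_real ((norm a)\<^sup>2)"
proof -
  have "cinner a a = (\<Sum>k\<in>UNIV. of_real ((cmod (a $ k))\<^sup>2))"
    unfolding cinner_def by (intro sum.cong refl) (metis complex_norm_square mult.commute of_real_power)
  thus ?thesis
    by (simp add: norm_vec_square)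
qed

lemma matrix_vector_mult_smult: "X *v (r *s a) = r *s (X *v a)" for X :: "complex^'n^'m"
  by (simp add: matrix_vector_mult_def vec_eq_iff sum_distrib_left mult.left_commute)

lemma of_real_smult_eq_scaleR: "complex_of_real r *s w = r *\<^sub>R (w :: complex^'n)"
proof -
  have "(complex_of_real r *s w) $ i = (r *\<^sub>R w) $ i" for i
  proof -
    have "(complex_of_real r *s w) $ i = r *\<^sub>R (w $ i)"
      by (simp add: scaleR_conv_of_real)
    thus ?thesis
      by simp
  qed
  thus ?thesis
    by (simp add: vec_eq_iff)
qed

lemma matrix_vector_mult_sum_left:
  "(\<Sum>j\<in>S. F j) *v (w :: complex^'n) = (\<Sum>j\<in>S. F j *v w)" for F :: "'a \<Rightarrow> complex^'n^'m"
  by (simp add: matrix_vector_mult_def vec_eq_iff sum_component sum_distrib_right) (intro allI sum.swap)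

lemma hermitian_matD:
  assumes "hermitian_mat X"
  shows "X $ i $ j = cnj (X $ j $ i)"
proof -
  have "X $ i $ j = cmat_adj X $ i $ j"
    using assms unfolding hermitian_mat_def by simp
  thus ?thesis
    by (simp add: cmat_adj_def)
qed

lemma hermitian_mat_iff: "hermitian_mat X \<longleftrightarrow> (\<forall>i j. X $ i $ j = cnj (X $ j $ i))"
proof
  assume X: "\<forall>i j. X $ i $ j = cnj (X $ j $ i)"
  have "cmat_adj X $ i $ j = X $ i $ j" for i j
    unfolding cmat_adj_def using X[rule_format, of i j] by (simp only: vec_lambda_beta)
  thus "hermitian_mat X"
    unfolding hermitian_mat_def by (simp add: vec_eq_iff)
qed (use hermitian_matD in blast)

lemma hermitian_cinner_mult:
  assumes "hermitian_mat X"
  shows "cinner a (X *v b) = cinner (X *v a) b"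
proof -
  have "cinner a (X *v b) = (\<Sum>k\<in>UNIV. \<Sum>j\<in>UNIV. cnj (a $ k) * X $ k $ j * b $ j)"
    by (simp add: cinner_def matrix_vector_mult_def sum_distrib_left mult.assoc)
  also have "\<dots> = (\<Sum>j\<in>UNIV. \<Sum>k\<in>UNIV. cnj (X $ j $ k * a $ k) * b $ j)"
    using assms by (subst sum.swap, intro sum.cong refl)
      (subst hermitian_matD[OF assms], simp add: mult_ac)
  also have "\<dots> = cinner (X *v a) b"
    by (simp add: cinner_def matrix_vector_mult_def sum_distrib_right)
  finally show ?thesis .
qed

lemma hermitian_mat_diff:
  assumes "hermitian_mat X" "hermitian_mat Y"
  shows "hermitian_mat (X - Y)"
proof -
  have "(X - Y) $ i $ j = cnj ((X - Y) $ j $ i)" for i j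
    using hermitian_matD[OF assms(1), of i j] hermitian_matD[OF assms(2), of i j] by simp
  thus ?thesis
    unfolding hermitian_mat_iff by blast
qed

lemma hermitian_outer_prod: "hermitian_mat (outer_prod f)"
  by (simp add: hermitian_mat_iff outer_prod_def mult.commute)

lemma hermitian_qform_real:
  assumes "hermitian_mat X"
  shows "Im (qform X w) = 0"
proof -
  have "qform X w = cinner (X *v w) w"
    by (simp add: qform_eq_cinner hermitian_cinner_mult[OF assms])
  also have "\<dots> = cnj (qform X w)"
    by (simp add: qform_eq_cinner cinner_commute[of "X *v w"])
  finally show ?thesis
    by (metis cnj.simps(2) neg_equal_zero)
qed

lemma psd_mat_iff: "psd_mat X \<longleftrightarrow> hermitian_mat X \<and> (\<forall>w. 0 \<le> Re (qform X w))"
  unfolding psd_mat_def using hermitian_qform_real by blast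

lemma outer_prod_mult_vector: "outer_prod f *v w = cinner f w *s f"
  by (simp add: outer_prod_def cinner_def vec_eq_iff matrix_vector_mult_def sum_distrib_left
      mult.commute mult.left_commute)

lemma qform_outer_prod: "qform (outer_prod g) w = of_real ((cmod (cinner g w))\<^sup>2)"
proof -
  have "qform (outer_prod g) w = cinner g w * cnj (cinner g w)"
    by (simp add: qform_eq_cinner outer_prod_mult_vector cinner_smult_right cinner_commute[of w g] mult.commute)
  thus ?thesis
    by (simp add: complex_mult_cnj cmod_power2)
qed

lemma qform_scaleR: "qform X (r *\<^sub>R w) = of_real (r\<^sup>2) * qform X w"
  by (simp add: qform_eq_cinner of_real_smult_eq_scaleR[symmetric] matrix_vector_mult_smult
      cinner_smult_left cinner_smult_right power2_eq_square)

lemma psd_mat_mult_eq_0_if_qform_eq_0: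
  assumes "psd_mat A" and "Re (qform A v) = 0"
  shows "A *v v = 0"
proof -
  have h: "hermitian_mat A" and pos: "\<And>w. 0 \<le> Re (qform A w)"
    using assms(1) by (auto simp: psd_mat_iff)
  define u where "u = A *v v"
  define n where "n = (norm u)\<^sup>2"
  define b where "b = Re (qform A u)"
  have b: "b \<ge> 0" and n: "n \<ge> 0"
    using pos by (simp_all add: b_def n_def)
  \<comment> \<open>along the line \<open>v + t u\<close> the form is \<open>2 t n + t\<^sup>2 b\<close>, which is negative for small \<open>t < 0\<close> unless \<open>n = 0\<close>\<close>
  have line: "Re (qform A (v + complex_of_real t *s u)) = 2 * t * n + t\<^sup>2 * b" for t
  proof -
    have "cinner v (A *v u) = cinner u u"
      using hermitian_cinner_mult[OF h, of v u] by (simp add: u_def cinner_commute[of u u] cinner_self)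
    moreover have "cinner u (A *v v) = cinner u u"
      by (simp add: u_def)
    ultimately have "qform A (v + complex_of_real t *s u)
        = qform A v + complex_of_real (2 * t * n) + complex_of_real (t\<^sup>2) * qform A u"
      by (simp add: qform_eq_cinner matrix_vector_right_distrib matrix_vector_mult_smult cinner_add_left
          cinner_add_right cinner_smult_left cinner_smult_right cinner_self n_def algebra_simps power2_eq_square)
    thus ?thesis
      using assms(2) by (simp add: b_def)
  qed
  define t where "t = - n / (b + 1)"
  have "0 \<le> (2 * t * n + t\<^sup>2 * b) * (b + 1)\<^sup>2"
    using pos[of "v + complex_of_real t *s u"] line[of t] b by simp
  also have "\<dots> = 2 * n * (b + 1) * (t * (b + 1)) + b * (t * (b + 1))\<^sup>2"
    by (simp add: algebra_simps power2_eq_square)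
  also have "t * (b + 1) = - n"
    using b by (simp add: t_def)
  also have "2 * n * (b + 1) * (- n) + b * (- n)\<^sup>2 = - (n\<^sup>2 * (b + 2))"
    by (simp add: algebra_simps power2_eq_square)
  finally have "n = 0"
    using b n by (smt (verit) mult_pos_pos zero_less_power)
  thus ?thesis
    by (simp add: n_def u_def)
qed

lemma continuous_on_Re_qform: "continuous_on UNIV (\<lambda>w. Re (qform X w))"
  unfolding qform_def matrix_vector_mult_def by (intro continuous_intros)

lemma psd_mat_top_eigenvector:
  fixes X :: "complex^'n^'n"
  assumes "psd_mat X"
  obtains v l where "norm v = 1" "X *v v = complex_of_real l *s v" "0 \<le> l"
    "\<And>w. Re (qform X w) \<le> l * (norm w)\<^sup>2"
proof -
  have pos: "\<And>w. 0 \<le> Re (qform X w)"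
    using assms by (auto simp: psd_mat_iff)
  have "norm (axis undefined (1::complex) :: complex^'n) = 1"
    by simp
  hence "sphere (0 :: complex^'n) 1 \<noteq> {}"
    by (metis mem_sphere_0 empty_iff)
  then obtain v where v: "v \<in> sphere 0 1"
    and vmax: "\<And>y. y \<in> sphere 0 1 \<Longrightarrow> Re (qform X y) \<le> Re (qform X v)"
    using continuous_attains_sup[OF compact_sphere _ continuous_on_subset[OF continuous_on_Re_qform]]
    by blast
  define l where "l = Re (qform X v)"
  have bound: "Re (qform X w) \<le> l * (norm w)\<^sup>2" for w
  proof (cases "w = 0")
    case False
    hence "(1 / norm w) *\<^sub>R w \<in> sphere 0 1"
      by simp
    hence "Re (qform X ((1 / norm w) *\<^sub>R w)) \<le> l"
      using vmax by (simp add: l_def)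
    hence "Re (qform X w) / (norm w)\<^sup>2 \<le> l"
      by (simp add: qform_scaleR power_divide)
    thus ?thesis
      using False by (simp add: divide_le_eq mult.commute)
  qed (simp add: qform_def)
  \<comment> \<open>\<open>l I - X\<close> is positive semidefinite and its form vanishes at \<open>v\<close>\<close>
  define A where "A = (\<chi> i j. (if i = j then complex_of_real l else 0) - X $ i $ j)"
  have Av: "A *v w = complex_of_real l *s w - X *v w" for w
    by (simp add: A_def vec_eq_iff matrix_vector_mult_def left_diff_distrib sum_subtractf
        if_distrib[of "\<lambda>x. x * _"] cong: if_cong)
  have "A $ i $ j = cnj (A $ j $ i)" for i j
    using hermitian_matD[of X i j] assms by (simp add: A_def psd_mat_iff)
  hence "hermitian_mat A"
    unfolding hermitian_mat_iff by blast
  moreover have "Re (qform A w) = l * (norm w)\<^sup>2 - Re (qform X w)" for w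
    by (simp add: qform_eq_cinner Av cinner_diff_right cinner_smult_right cinner_self)
  ultimately have "psd_mat A" "Re (qform A v) = 0"
    using bound v by (auto simp: psd_mat_iff l_def)
  hence "A *v v = 0"
    by (rule psd_mat_mult_eq_0_if_qform_eq_0)
  hence "X *v v = complex_of_real l *s v"
    by (simp add: Av)
  moreover have "norm v = 1" "0 \<le> l"
    using v pos[of v] by (simp_all add: l_def)
  ultimately show thesis
    using that bound by blast
qed

lemma deflate_mult_eigenvector:
  assumes nv: "norm v = 1" and ev: "X *v v = complex_of_real l *s v" and l: "0 \<le> l"
  defines "f \<equiv> complex_of_real (sqrt l) *s v"
  shows "(X - outer_prod f) *v v = 0"
proof -
  have "cinner f v = complex_of_real (sqrt l)"
    using nv by (simp add: f_def cinner_smult_left cinner_self)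
  hence "cinner f v *s f = (complex_of_real (sqrt l) * complex_of_real (sqrt l)) *s v"
    by (simp add: f_def vector_smult_assoc)
  also have "\<dots> = complex_of_real l *s v"
    using l by (simp flip: of_real_mult)
  finally show ?thesis
    by (simp add: matrix_vector_mult_diff_rdistrib outer_prod_mult_vector ev)
qed

lemma psd_mat_deflate:
  fixes X :: "complex^'n^'n"
  assumes psd: "psd_mat X" and nv: "norm v = 1" and ev: "X *v v = complex_of_real l *s v"
    and l: "0 \<le> l"
  defines "f \<equiv> complex_of_real (sqrt l) *s v"
  shows "psd_mat (X - outer_prod f)"
  unfolding psd_mat_iff
proof (intro conjI allI)
  have h: "hermitian_mat X" and pos: "\<And>w. 0 \<le> Re (qform X w)"
    using psd by (auto simp: psd_mat_iff)
  show "hermitian_mat (X - outer_prod f)"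
    by (intro hermitian_mat_diff h hermitian_outer_prod)
  fix w
  \<comment> \<open>split \<open>w\<close> along \<open>v\<close>: the deflated form only sees the component orthogonal to \<open>v\<close>\<close>
  define a where "a = cinner v w"
  define u where "u = w - a *s v"
  have w: "w = a *s v + u"
    by (simp add: u_def)
  have vv: "cinner v v = 1"
    using nv by (simp add: cinner_self)
  have vu: "cinner v u = 0"
    by (simp add: u_def cinner_diff_right cinner_smult_right vv a_def)
  have uv: "cinner u v = 0"
    using vu by (simp add: cinner_commute[of v u])
  have vXu: "cinner v (X *v u) = 0"
    by (simp add: hermitian_cinner_mult[OF h] ev cinner_smult_left vu)
  have "qform X w = cnj a * a * complex_of_real l * cinner v v + cnj a * cinner v (X *v u)
      + a * complex_of_real l * cinner u v + cinner u (X *v u)"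
    unfolding qform_eq_cinner w
    by (simp add: matrix_vector_right_distrib matrix_vector_mult_smult ev cinner_add_left
        cinner_add_right cinner_smult_left cinner_smult_right vector_smult_assoc algebra_simps)
  also have "\<dots> = complex_of_real (l * (cmod a)\<^sup>2) + qform X u"
  proof -
    have "a * cnj a = complex_of_real ((cmod a)\<^sup>2)"
      by (simp add: complex_mult_cnj cmod_power2)
    thus ?thesis
      by (simp add: vv vXu uv qform_eq_cinner mult.commute mult.left_commute)
  qed
  finally have "Re (qform X w) = l * (cmod a)\<^sup>2 + Re (qform X u)"
    by simp
  moreover have "Re (qform (outer_prod f) w) = l * (cmod a)\<^sup>2"
    using l by (simp add: qform_outer_prod f_def cinner_smult_left a_def norm_mult power_mult_distrib)
  moreover have "Re (qform (X - outer_prod f) w) = Re (qform X w) - Re (qform (outer_prod f) w)"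
    by (simp add: qform_eq_cinner matrix_vector_mult_diff_rdistrib cinner_diff_right)
  ultimately show "0 \<le> Re (qform (X - outer_prod f) w)"
    using pos[of u] by simp
qed

lemma range_deflate_psubset:
  fixes X :: "complex^'n^'n"
  assumes h: "hermitian_mat X" and nv: "norm v = 1" and ev: "X *v v = complex_of_real l *s v"
    and l: "0 < l"
  defines "f \<equiv> complex_of_real (sqrt l) *s v"
  shows "range ((*v) (X - outer_prod f)) \<subset> range ((*v) X)"
    and "f \<in> range ((*v) X)"
proof -
  define X' where "X' = X - outer_prod f"
  have X_inv: "X *v ((c / complex_of_real l) *s v) = c *s v" for c
    using l by (simp add: matrix_vector_mult_smult ev vector_smult_assoc)
  show "f \<in> range ((*v) X)"
    using X_inv[of "complex_of_real (sqrt l)"] by (metis f_def rangeI)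
  have "range ((*v) X') \<subseteq> range ((*v) X)"
  proof
    fix y assume "y \<in> range ((*v) X')"
    then obtain w where "y = X' *v w"
      by blast
    also have "\<dots> = X *v (w - (cinner f w * complex_of_real (sqrt l) / complex_of_real l) *s v)"
      using X_inv[of "cinner f w * complex_of_real (sqrt l)"]
      by (simp add: X'_def matrix_vector_mult_diff_rdistrib outer_prod_mult_vector
          matrix_vector_mult_diff_distrib f_def vector_smult_assoc)
    finally show "y \<in> range ((*v) X)"
      by blast
  qed
  moreover have "v \<in> range ((*v) X)"
    using X_inv[of 1] by (metis rangeI vector_smult_lid)
  moreover have "v \<notin> range ((*v) X')"
  proof
    assume "v \<in> range ((*v) X')"
    then obtain w where "X' *v w = v"
      by blast
    hence "cinner v v = cinner (X' *v v) w"
      by (metis hermitian_cinner_mult hermitian_mat_diff[OF h hermitian_outer_prod] X'_def)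
    thus False
      using nv deflate_mult_eigenvector[OF nv ev less_imp_le[OF l]]
      by (simp add: X'_def f_def cinner_self)
  qed
  ultimately show "range ((*v) X') \<subset> range ((*v) X)"
    by blast
qed

lemma psd_mat_pos_eigenvector:
  fixes X :: "complex^'n^'n"
  assumes "psd_mat X" and "X \<noteq> 0"
  obtains v l where "norm v = 1" "X *v v = complex_of_real l *s v" "0 < l"
proof -
  obtain v l where nv: "norm v = 1" and ev: "X *v v = complex_of_real l *s v" and l: "0 \<le> l"
    and top: "\<And>w. Re (qform X w) \<le> l * (norm w)\<^sup>2"
    using psd_mat_top_eigenvector[OF assms(1)] by blast
  have "l \<noteq> 0"
  proof
    assume "l = 0"
    hence "Re (qform X w) = 0" for w
      using top[of w] assms(1) unfolding psd_mat_iff by (simp add: order_antisym)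
    hence "X *v w = 0" for w
      using psd_mat_mult_eq_0_if_qform_eq_0[OF assms(1)] by blast
    thus False
      using assms(2) by (simp add: matrix_eq)
  qed
  hence "0 < l"
    using l by simp
  thus thesis
    by (rule that[OF nv ev])
qed

lemma dim_range_mult_less:
  fixes A B :: "complex^'n^'m"
  assumes "range ((*v) A) \<subset> range ((*v) B)"
  shows "dim (range ((*v) A)) < dim (range ((*v) B))"
proof -
  have span_range: "span (range ((*v) Y)) = range ((*v) Y)" for Y :: "complex^'n^'m"
    by (intro span_eq_iff[THEN iffD2] linear_subspace_image matrix_vector_mul_linear subspace_UNIV)
  show ?thesis
    by (rule eucl.dim_psubset) (unfold span_range, rule assms)
qed

lemma psd_mat_eq_sum_outer_prod:
  fixes X :: "complex^'n^'n"
  assumes "psd_mat X"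
  obtains m :: nat and f where "X = (\<Sum>j<m. outer_prod (f j))"
    and "\<And>j k. j < m \<Longrightarrow> k < m \<Longrightarrow> j \<noteq> k \<Longrightarrow> cinner (f j) (f k) = 0"
proof -
  have "\<exists>(m::nat) f. X = (\<Sum>j<m. outer_prod (f j))
      \<and> (\<forall>j<m. \<forall>k<m. j \<noteq> k \<longrightarrow> cinner (f j) (f k) = 0) \<and> (\<forall>j<m. f j \<in> range ((*v) X))"
    if "dim (range ((*v) X)) = d" "psd_mat X" for d and X :: "complex^'n^'n"
    using that
  proof (induction d arbitrary: X rule: less_induct)
    case (less d X)
    show ?case
    proof (cases "X = 0")
      case True
      show ?thesis
        by (rule exI[of _ "0::nat"]) (simp add: True)
    next
      case False
      obtain v l where nv: "norm v = 1" and ev: "X *v v = complex_of_real l *s v" and l: "0 < l"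
        using psd_mat_pos_eigenvector[OF less.prems(2) False] by blast
      have h: "hermitian_mat X"
        using less.prems(2) by (simp add: psd_mat_iff)
      define g where "g = complex_of_real (sqrt l) *s v"
      define X' where "X' = X - outer_prod g"
      note range = range_deflate_psubset[OF h nv ev l, folded g_def, folded X'_def]
      have X'_psd: "psd_mat X'"
        unfolding X'_def g_def using less.prems(2) nv ev l by (intro psd_mat_deflate) auto
      have "dim (range ((*v) X')) < d"
        using dim_range_mult_less[OF range(1)] less.prems(1) by simp
      then obtain m :: nat and f where X': "X' = (\<Sum>j<m. outer_prod (f j))"
        and orth: "\<forall>j<m. \<forall>k<m. j \<noteq> k \<longrightarrow> cinner (f j) (f k) = 0"
        and rng: "\<forall>j<m. f j \<in> range ((*v) X')"
        using less.IH[OF _ refl X'_psd] by blast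
      \<comment> \<open>\<open>g\<close> is orthogonal to the range of the Hermitian \<open>X'\<close>, because \<open>X' g = 0\<close>\<close>
      have "cinner g (X' *v w) = 0" for w
        using hermitian_cinner_mult[OF hermitian_mat_diff[OF h hermitian_outer_prod], of g]
          deflate_mult_eigenvector[OF nv ev less_imp_le[OF l]]
        by (simp add: X'_def g_def matrix_vector_mult_smult)
      hence g_orth: "cinner g (f j) = 0" "cinner (f j) g = 0" if "j < m" for j
        using rng that cinner_commute[of "f j" g] by auto
      define h where "h j = (case j of 0 \<Rightarrow> g | Suc k \<Rightarrow> f k)" for j
      show ?thesis
      proof (intro exI[of _ "Suc m"] exI[of _ h] conjI allI impI)
        show "X = (\<Sum>j<Suc m. outer_prod (h j))"
          unfolding sum.lessThan_Suc_shift by (simp add: h_def X'[symmetric] X'_def)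
        show "cinner (h j) (h k) = 0" if "j < Suc m" "k < Suc m" "j \<noteq> k" for j k
          using that orth g_orth by (cases j; cases k) (auto simp: h_def)
        show "h j \<in> range ((*v) X)" if "j < Suc m" for j
          using that rng psubset_imp_subset[OF range(1)] range(2)
          by (cases j) (auto simp: h_def)
      qed
    qed
  qed
  from this[OF refl assms] show thesis
    using that by blast
qed

section \<open>Randomized rounding of a positive semidefinite matrix\<close>

lemma Re_qform_sum_outer_prod:
  fixes n :: nat
  shows "Re (qform (\<Sum>l<n. outer_prod (g l)) w) = (\<Sum>l<n. (cmod (cinner (g l) w))\<^sup>2)"
  by (simp add: qform_eq_cinner matrix_vector_mult_sum_left cinner_sum_right
      qform_outer_prod[unfolded qform_eq_cinner] Re_sum)

lemma ctrace_mult_sum_outer_prod: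
  fixes m :: nat
  shows "ctrace (H ** (\<Sum>j<m. outer_prod (f j))) = (\<Sum>j<m. qform H (f j))"
proof -
  have "ctrace (H ** (\<Sum>j<m. outer_prod (f j)))
      = (\<Sum>i\<in>UNIV. \<Sum>k\<in>UNIV. \<Sum>j<m. H $ i $ k * (f j $ k * cnj (f j $ i)))"
    by (simp add: ctrace_def matrix_matrix_mult_def sum_component outer_prod_def sum_distrib_left)
  also have "\<dots> = (\<Sum>j<m. \<Sum>i\<in>UNIV. \<Sum>k\<in>UNIV. H $ i $ k * (f j $ k * cnj (f j $ i)))"
    by (simp add: sum.swap[of _ "{..<m}"])
  also have "\<dots> = (\<Sum>j<m. qform H (f j))"
    by (simp add: qform_def matrix_vector_mult_def sum_distrib_left mult.commute mult.left_commute)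
  finally show ?thesis .
qed

lemma Re_ctrace_sum_outer_prod:
  fixes m :: nat
  shows "Re (ctrace (\<Sum>j<m. outer_prod (f j))) = (\<Sum>j<m. (norm (f j))\<^sup>2)"
proof -
  have "Re (ctrace (\<Sum>j<m. outer_prod (f j))) = (\<Sum>i\<in>UNIV. \<Sum>j<m. Re (f j $ i * cnj (f j $ i)))"
    by (simp add: ctrace_def sum_component outer_prod_def Re_sum)
  also have "\<dots> = (\<Sum>j<m. \<Sum>i\<in>UNIV. (cmod (f j $ i))\<^sup>2)"
    by (subst sum.swap) (simp add: complex_mult_cnj cmod_power2)
  finally show ?thesis
    by (simp add: norm_vec_square)
qed

lemma psd_mat_Re_ctrace_nonneg:
  assumes "psd_mat X"
  shows "0 \<le> Re (ctrace X)"
proof -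
  obtain m :: nat and f where "X = (\<Sum>j<m. outer_prod (f j))"
    using psd_mat_eq_sum_outer_prod[OF assms] by blast
  thus ?thesis
    by (simp add: Re_ctrace_sum_outer_prod sum_nonneg)
qed

lemma cinner_sum_scaleR_right:
  fixes m :: nat
  shows "cinner g (\<Sum>j<m. s j *\<^sub>R f j) = (\<Sum>j<m. complex_of_real (s j) * cinner g (f j))"
  by (simp add: cinner_sum_right of_real_smult_eq_scaleR[symmetric] cinner_smult_right)

lemma norm_sum_scaleR_orthogonal:
  fixes m :: nat
  assumes orth: "\<And>j k. j < m \<Longrightarrow> k < m \<Longrightarrow> j \<noteq> k \<Longrightarrow> cinner (f j) (f k) = 0"
  shows "(norm (\<Sum>j<m. s j *\<^sub>R f j))\<^sup>2 = (\<Sum>j<m. (s j)\<^sup>2 * (norm (f j))\<^sup>2)"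
proof -
  have diag: "(\<Sum>j<m. complex_of_real (s j) * cinner (f j) (f k)) = complex_of_real (s k) * cinner (f k) (f k)"
    if "k < m" for k
  proof -
    have "(\<Sum>j\<in>{..<m}-{k}. complex_of_real (s j) * cinner (f j) (f k)) = 0"
      using that orth by (intro sum.neutral) auto
    moreover have "(\<Sum>j<m. complex_of_real (s j) * cinner (f j) (f k))
        = complex_of_real (s k) * cinner (f k) (f k)
          + (\<Sum>j\<in>{..<m}-{k}. complex_of_real (s j) * cinner (f j) (f k))"
      using that by (intro sum.remove) auto
    ultimately show ?thesis
      by simp
  qed
  have row: "cinner (\<Sum>j<m. s j *\<^sub>R f j) (f k) = (\<Sum>j<m. complex_of_real (s j) * cinner (f j) (f k))"
    for k
  proof -
    have "cinner (\<Sum>j<m. s j *\<^sub>R f j) (f k) = cnj (cinner (f k) (\<Sum>j<m. s j *\<^sub>R f j))"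
      by (rule cinner_commute)
    also have "\<dots> = (\<Sum>j<m. complex_of_real (s j) * cinner (f j) (f k))"
      by (simp add: cinner_sum_scaleR_right cinner_commute[of "f k"])
    finally show ?thesis .
  qed
  have "complex_of_real ((norm (\<Sum>j<m. s j *\<^sub>R f j))\<^sup>2)
      = cinner (\<Sum>j<m. s j *\<^sub>R f j) (\<Sum>j<m. s j *\<^sub>R f j)"
    by (simp add: cinner_self)
  also have "\<dots> = (\<Sum>k<m. complex_of_real (s k) * (\<Sum>j<m. complex_of_real (s j) * cinner (f j) (f k)))"
    by (simp add: cinner_sum_scaleR_right row)
  also have "\<dots> = complex_of_real (\<Sum>j<m. (s j)\<^sup>2 * (norm (f j))\<^sup>2)"
    by (simp add: diag cinner_self power2_eq_square mult.assoc)
  finally show ?thesis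
    by (simp only: of_real_eq_iff)
qed

lemma card_sign_vectors_qform_gt_le:
  fixes H :: "complex^'n^'n" and f :: "nat \<Rightarrow> complex^'n" and m :: nat
  assumes "psd_mat H"
  shows "real (card {s\<in>sign_vectors m. t * Re (ctrace (H ** (\<Sum>j<m. outer_prod (f j))))
            < Re (qform H (\<Sum>j<m. s j *\<^sub>R f j))})
           \<le> 28 * 2 ^ m * exp (- t / 4)"
proof -
  obtain n :: nat and g where H: "H = (\<Sum>l<n. outer_prod (g l))"
    using psd_mat_eq_sum_outer_prod[OF assms] by blast
  define c where "c l j = cinner (g l) (f j)" for l j
  have "Re (ctrace (H ** (\<Sum>j<m. outer_prod (f j)))) = (\<Sum>j<m. \<Sum>l<n. (cmod (c l j))\<^sup>2)"
    by (simp add: ctrace_mult_sum_outer_prod Re_sum H Re_qform_sum_outer_prod c_def)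
  also have "\<dots> = (\<Sum>l<n. \<Sum>j<m. (cmod (c l j))\<^sup>2)"
    by (rule sum.swap)
  finally have trace: "Re (ctrace (H ** (\<Sum>j<m. outer_prod (f j)))) = (\<Sum>l<n. \<Sum>j<m. (cmod (c l j))\<^sup>2)" .
  have "Re (qform H (\<Sum>j<m. s j *\<^sub>R f j)) = (\<Sum>l<n. (cmod (\<Sum>j<m. of_real (s j) * c l j))\<^sup>2)" for s
    by (simp add: H Re_qform_sum_outer_prod cinner_sum_scaleR_right c_def)
  thus ?thesis
    unfolding trace using card_sum_complex_rademacher_tail_le[where t=t and n=n and m=m and c=c]
    by simp
qed

lemma psd_mat_randomized_rounding:
  fixes H :: "nat \<Rightarrow> complex^'n^'n" and X :: "complex^'n^'n"
  assumes H: "\<forall>i\<in>I. psd_mat (H i)" and "finite I" and X: "psd_mat X"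
    and K: "real (card {i\<in>I. H i \<noteq> 0}) \<le> K" "0 < K"
  obtains w where "(norm w)\<^sup>2 = Re (ctrace X)"
    and "\<And>i. i \<in> I \<Longrightarrow> Re (qform (H i) w) \<le> 4 * ln (100 * K) * Re (ctrace (H i ** X))"
proof -
  obtain m :: nat and f where Xf: "X = (\<Sum>j<m. outer_prod (f j))"
    and orth: "\<And>j k. j < m \<Longrightarrow> k < m \<Longrightarrow> j \<noteq> k \<Longrightarrow> cinner (f j) (f k) = 0"
    using psd_mat_eq_sum_outer_prod[OF X] by blast
  define t where "t = 4 * ln (100 * K)"
  define w where "w s = (\<Sum>j<m. s j *\<^sub>R f j)" for s
  define Bad where "Bad i = {s\<in>sign_vectors m. t * Re (ctrace (H i ** X)) < Re (qform (H i) (w s))}" for i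
  define NZ where "NZ = {i\<in>I. H i \<noteq> 0}"
  have "Bad i = {}" if "H i = 0" for i
    using that by (simp add: Bad_def qform_def ctrace_def matrix_matrix_mult_def)
  hence "(\<Sum>i\<in>I. real (card (Bad i))) = (\<Sum>i\<in>NZ. real (card (Bad i)))"
    using \<open>finite I\<close> by (intro sum.mono_neutral_right) (auto simp: NZ_def)
  moreover have "card (\<Union>i\<in>I. Bad i) \<le> (\<Sum>i\<in>I. card (Bad i))"
    using \<open>finite I\<close> by (rule card_UN_le)
  ultimately have "real (card (\<Union>i\<in>I. Bad i)) \<le> (\<Sum>i\<in>NZ. real (card (Bad i)))"
    by (metis of_nat_le_iff of_nat_sum)
  also have "\<dots> \<le> (\<Sum>i\<in>NZ. 28 * 2 ^ m * exp (- t / 4))"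
    using H unfolding Bad_def w_def Xf by (intro sum_mono card_sign_vectors_qform_gt_le) (auto simp: NZ_def)
  also have "\<dots> = real (card NZ) * (28 * 2 ^ m / (100 * K))"
    using K by (simp add: t_def exp_minus exp_ln inverse_eq_divide)
  also have "\<dots> \<le> K * (28 * 2 ^ m / (100 * K))"
    using K by (intro mult_right_mono) (auto simp: NZ_def)
  also have "\<dots> < 2 ^ m"
    using K by simp
  finally have "card (\<Union>i\<in>I. Bad i) < card (sign_vectors m)"
    by (simp add: card_sign_vectors)
  hence "\<not> sign_vectors m \<subseteq> (\<Union>i\<in>I. Bad i)"
    using \<open>finite I\<close> by (auto dest: card_mono[rotated] simp: Bad_def)
  then obtain s where s: "s \<in> sign_vectors m" and good: "\<And>i. i \<in> I \<Longrightarrow> s \<notin> Bad i"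
    by blast
  show thesis
  proof
    have "(norm (w s))\<^sup>2 = (\<Sum>j<m. (s j)\<^sup>2 * (norm (f j))\<^sup>2)"
      unfolding w_def using orth by (rule norm_sum_scaleR_orthogonal)
    also have "\<dots> = Re (ctrace X)"
      using sign_vectors_square[OF s] by (simp add: Xf Re_ctrace_sum_outer_prod)
    finally show "(norm (w s))\<^sup>2 = Re (ctrace X)" .
    show "Re (qform (H i) (w s)) \<le> 4 * ln (100 * K) * Re (ctrace (H i ** X))" if "i \<in> I" for i
      using good[OF that] s by (simp add: Bad_def t_def not_less)
  qed
qed

section \<open>From the SDP relaxation to the quadratic program\<close>

lemma rank_eq_0_complex: "rank (A :: complex^'n^'m) = 0 \<longleftrightarrow> A = 0"
proof
  assume "rank A = 0"
  hence "rows A \<subseteq> {0}"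
    unfolding row_rank_def_gen by (simp only: vec.dim_eq_0)
  hence "row i A = 0" for i
    unfolding rows_def by blast
  hence "A $ i $ j = 0" for i j
    by (metis row_def vec_lambda_beta zero_index)
  thus "A = 0"
    by (simp add: vec_eq_iff)
next
  assume "A = 0"
  hence "rows A \<subseteq> {0}"
    by (auto simp: rows_def row_def vec_eq_iff)
  thus "rank A = 0"
    unfolding row_rank_def_gen by (simp only: vec.dim_eq_0)
qed

lemma card_nonzero_le_sum_min_rank:
  fixes H :: "nat \<Rightarrow> complex^'n^'n"
  assumes "1 \<le> M"
  shows "real (card {i\<in>{1..M}. H i \<noteq> 0}) \<le> (\<Sum>i=1..M. min (real (rank (H i))) (sqrt (real M)))"
proof -
  have "real (card {i\<in>{1..M}. H i \<noteq> 0}) = (\<Sum>i\<in>{i\<in>{1..M}. H i \<noteq> 0}. 1)"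
    by simp
  also have "\<dots> \<le> (\<Sum>i\<in>{i\<in>{1..M}. H i \<noteq> 0}. min (real (rank (H i))) (sqrt (real M)))"
    using assms rank_eq_0_complex[of "H _"] by (intro sum_mono) (auto simp: Suc_le_eq)
  also have "\<dots> \<le> (\<Sum>i=1..M. min (real (rank (H i))) (sqrt (real M)))"
    by (intro sum_mono2) auto
  finally show ?thesis .
qed

lemma sum_min_rank_eq_0_or_ge_1:
  fixes H :: "nat \<Rightarrow> complex^'n^'n"
  assumes "1 \<le> M"
  shows "(\<Sum>i=1..M. min (real (rank (H i))) (sqrt (real M))) = 0
    \<or> 1 \<le> (\<Sum>i=1..M. min (real (rank (H i))) (sqrt (real M)))"
proof (cases "\<forall>i\<in>{1..M}. H i = 0")
  case True
  thus ?thesis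
    by (simp add: rank_eq_0_complex[THEN iffD2])
next
  case False
  hence "0 < card {i\<in>{1..M}. H i \<noteq> 0}"
    by (subst card_gt_0_iff) auto
  thus ?thesis
    using card_nonzero_le_sum_min_rank[OF assms, of H] by linarith
qed

lemma exists_subset_large_weights:
  fixes \<beta> :: "nat \<Rightarrow> real" and M Q :: nat
  assumes sum: "(\<Sum>i=1..M. \<beta> i) = real Q" and bounds: "\<forall>i\<in>{1..M}. 0 \<le> \<beta> i \<and> \<beta> i \<le> 1"
    and "Q < M"
  obtains S where "S \<subseteq> {1..M}" "card S = Q" "\<forall>i\<in>S. 1 / (real M - real Q + 1) \<le> \<beta> i"
proof -
  define D where "D = real M - real Q + 1"
  define T where "T = {i\<in>{1..M}. 1 / D \<le> \<beta> i}"
  have D: "2 \<le> D"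
    using \<open>Q < M\<close> by (simp add: D_def)
  \<comment> \<open>otherwise the weights would sum to at most \<open>|T| + (M - |T|)/D < Q\<close>\<close>
  have "Q \<le> card T"
  proof (rule ccontr)
    assume "\<not> Q \<le> card T"
    hence T_le: "real (card T) \<le> real Q - 1"
      by linarith
    define R where "R = {1..M} - T"
    have TR: "T \<subseteq> {1..M}" "finite T"
      by (auto simp: T_def)
    moreover have "card T \<le> M"
      using card_mono[OF _ TR(1)] by simp
    ultimately have card_R: "real (card R) = real M - real (card T)"
      by (simp add: R_def card_Diff_subset of_nat_diff)
    have "R \<noteq> {}"
      using T_le card_R \<open>Q < M\<close> by auto
    have "real Q = (\<Sum>i\<in>T. \<beta> i) + (\<Sum>i\<in>R. \<beta> i)"
      unfolding R_def using sum sum.subset_diff[OF TR(1) finite_atLeastAtMost, of \<beta>] by linarith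
    also have "\<dots> < (\<Sum>i\<in>T. 1) + (\<Sum>i\<in>R. 1 / D)"
      using bounds TR \<open>R \<noteq> {}\<close>
      by (intro add_le_less_mono sum_mono sum_strict_mono) (auto simp: R_def T_def)
    also have "\<dots> = real (card T) + (real M - real (card T)) / D"
      using card_R by simp
    also have "\<dots> \<le> real Q"
    proof -
      have "(real M - real Q) * (real (card T) - real Q + 1) \<le> 0"
        using T_le \<open>Q < M\<close> by (intro mult_nonneg_nonpos) auto
      thus ?thesis
        using D by (simp add: D_def field_simps)
    qed
    finally show False
      by simp
  qed
  then obtain S where "S \<subseteq> T" "card S = Q"
    by (meson obtain_subset_with_card_n)
  thus thesis
    by (intro that[of S]) (auto simp: T_def D_def)
qed

definition qp_feasible ::
    "nat \<Rightarrow> nat \<Rightarrow> real \<Rightarrow> (nat \<Rightarrow> complex^'n^'n) \<Rightarrow> complex^'n \<Rightarrow> (nat \<Rightarrow> real) \<Rightarrow> bool" where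
  "qp_feasible M Q \<epsilon> H w \<beta> \<longleftrightarrow>
     (\<forall>i\<in>{1..M}. \<beta> i \<in> {0, 1}) \<and>
     (\<forall>i\<in>{1..M}. Re (qform (H i) w) \<le> \<beta> i * \<epsilon> + (1 - \<beta> i)) \<and>
     (\<Sum>i=1..M. \<beta> i) = real Q"

definition sdp_feasible ::
    "nat \<Rightarrow> nat \<Rightarrow> real \<Rightarrow> (nat \<Rightarrow> complex^'n^'n) \<Rightarrow> complex^'n^'n \<Rightarrow> (nat \<Rightarrow> real) \<Rightarrow> bool" where
  "sdp_feasible M Q \<epsilon> H X \<beta> \<longleftrightarrow>
     psd_mat X \<and>
     (\<forall>i\<in>{1..M}. Re (ctrace (H i ** X)) \<le> \<beta> i * \<epsilon> + (1 - \<beta> i)) \<and>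
     (\<Sum>i=1..M. \<beta> i) = real Q \<and>
     (\<forall>i\<in>{1..M}. 0 \<le> \<beta> i \<and> \<beta> i \<le> 1)"

lemma sum_indicator_atLeastAtMost:
  fixes M :: nat
  assumes "S \<subseteq> {1..M}"
  shows "(\<Sum>i=1..M. if i \<in> S then 1 else 0 :: real) = real (card S)"
proof -
  have "(\<Sum>i=1..M. if i \<in> S then 1 else 0 :: real) = (\<Sum>i\<in>S. 1)"
    using assms by (intro sum.mono_neutral_cong_right) auto
  thus ?thesis
    by simp
qed

lemma qp_feasible_zero:
  assumes "Q \<le> M" "0 \<le> \<epsilon>"
  shows "qp_feasible M Q \<epsilon> H 0 (\<lambda>i. if i \<in> {1..Q} then 1 else 0)"
  using assms sum_indicator_atLeastAtMost[of "{1..Q}" M]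
  by (auto simp: qp_feasible_def qform_def simp del: atLeastAtMost_iff)

lemma scaled_v_SDP_le_v_QP:
  assumes "0 \<le> c" "Q \<le> M" "0 \<le> \<epsilon>"
    and lift: "\<And>X \<beta>. sdp_feasible M Q \<epsilon> H X \<beta> \<Longrightarrow>
                 \<exists>w \<beta>'. qp_feasible M Q \<epsilon> H w \<beta>' \<and> (norm w)\<^sup>2 = c * Re (ctrace X)"
  shows "ereal c * v_SDP M Q \<epsilon> H \<le> v_QP M Q \<epsilon> H"
proof -
  define F where "F = {(X, \<beta>). sdp_feasible M Q \<epsilon> H X \<beta>}"
  have "psd_mat (0 :: complex^'n^'n)"
    by (simp add: psd_mat_iff hermitian_mat_iff qform_def)
  hence "sdp_feasible M Q \<epsilon> H 0 (\<lambda>i. if i \<in> {1..Q} then 1 else 0)"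
    using assms sum_indicator_atLeastAtMost[of "{1..Q}" M]
    by (auto simp: sdp_feasible_def ctrace_def matrix_matrix_mult_def simp del: atLeastAtMost_iff)
  hence "F \<noteq> {}"
    by (auto simp: F_def)
  hence "ereal c * v_SDP M Q \<epsilon> H = (SUP p\<in>F. ereal c * ereal (Re (ctrace (fst p))))"
    using \<open>0 \<le> c\<close> unfolding v_SDP_def sdp_feasible_def[symmetric] F_def
    by (intro SUP_ereal_mult_left[symmetric])
      (auto simp: sdp_feasible_def intro: psd_mat_Re_ctrace_nonneg)
  also have "\<dots> \<le> v_QP M Q \<epsilon> H"
  proof (rule SUP_least)
    fix p assume "p \<in> F"
    then obtain X \<beta> where p: "p = (X, \<beta>)" and X: "sdp_feasible M Q \<epsilon> H X \<beta>"
      by (auto simp: F_def)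
    then obtain w \<beta>' where "qp_feasible M Q \<epsilon> H w \<beta>'" "(norm w)\<^sup>2 = c * Re (ctrace (fst p))"
      using lift[OF X] by auto
    thus "ereal c * ereal (Re (ctrace (fst p))) \<le> v_QP M Q \<epsilon> H"
      unfolding v_QP_def qp_feasible_def[symmetric]
      by (intro SUP_upper2[of "(w, \<beta>')"]) auto
  qed
  finally show ?thesis .
qed

lemma eps_le_c_tilde:
  assumes "Q < M" "\<epsilon> < 1"
  shows "\<epsilon> \<le> 1 - (1 - \<epsilon>) / (real M - real Q + 1)"
proof -
  have "(1 - \<epsilon>) / (real M - real Q + 1) \<le> (1 - \<epsilon>) / 1"
    using assms by (intro divide_left_mono) auto
  thus ?thesis
    by simp
qed

lemma sdp_constraint_le:
  fixes r \<beta> \<epsilon> D :: real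
  assumes "r \<le> \<beta> * \<epsilon> + (1 - \<beta>)" "0 \<le> \<beta>" "\<epsilon> < 1"
  shows "r \<le> 1" and "1 / D \<le> \<beta> \<Longrightarrow> r \<le> 1 - (1 - \<epsilon>) / D"
proof -
  have r: "r \<le> 1 - \<beta> * (1 - \<epsilon>)"
    using assms(1) by (simp add: algebra_simps)
  moreover have "0 \<le> \<beta> * (1 - \<epsilon>)"
    using assms(2,3) by simp
  ultimately show "r \<le> 1"
    by linarith
  assume "1 / D \<le> \<beta>"
  hence "1 / D * (1 - \<epsilon>) \<le> \<beta> * (1 - \<epsilon>)"
    using assms(3) by (intro mult_right_mono) auto
  thus "r \<le> 1 - (1 - \<epsilon>) / D"
    using r by simp
qed

lemma sdp_feasible_rounding:
  fixes H :: "nat \<Rightarrow> complex^'n^'n"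
  assumes H: "\<forall>i\<in>{1..M}. psd_mat (H i)" and "Q < M" and \<epsilon>: "0 < \<epsilon>" "\<epsilon> < 1"
    and K: "real (card {i\<in>{1..M}. H i \<noteq> 0}) \<le> K" "1 \<le> K"
    and feasible: "sdp_feasible M Q \<epsilon> H X \<beta>"
  shows "\<exists>w \<beta>'. qp_feasible M Q \<epsilon> H w \<beta>' \<and>
           (norm w)\<^sup>2 = \<epsilon> / (1 - (1 - \<epsilon>) / (real M - real Q + 1)) / (4 * ln (100 * K)) * Re (ctrace X)"
proof -
  define D where "D = real M - real Q + 1"
  define c where "c = 1 - (1 - \<epsilon>) / D"
  define \<alpha> where "\<alpha> = \<epsilon> / c"
  define t where "t = 4 * ln (100 * K)"
  have c: "\<epsilon> \<le> c" "0 < c"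
    using eps_le_c_tilde[OF \<open>Q < M\<close> \<epsilon>(2)] \<epsilon> by (auto simp: c_def D_def)
  hence \<alpha>: "0 < \<alpha>" "\<alpha> \<le> 1" "\<alpha> * c = \<epsilon>"
    using \<epsilon> by (auto simp: \<alpha>_def)
  have t: "0 < t"
    using K by (simp add: t_def)
  have X: "psd_mat X" and cons: "\<forall>i\<in>{1..M}. Re (ctrace (H i ** X)) \<le> \<beta> i * \<epsilon> + (1 - \<beta> i)"
    and sum: "(\<Sum>i=1..M. \<beta> i) = real Q" and bounds: "\<forall>i\<in>{1..M}. 0 \<le> \<beta> i \<and> \<beta> i \<le> 1"
    using feasible by (auto simp: sdp_feasible_def)
  obtain w where w: "(norm w)\<^sup>2 = Re (ctrace X)"
    and w_le: "\<And>i. i \<in> {1..M} \<Longrightarrow> Re (qform (H i) w) \<le> t * Re (ctrace (H i ** X))"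
    using psd_mat_randomized_rounding[OF H _ X K(1)] K(2) by (auto simp: t_def)
  obtain S where S: "S \<subseteq> {1..M}" "card S = Q" "\<forall>i\<in>S. 1 / D \<le> \<beta> i"
    using exists_subset_large_weights[OF sum bounds \<open>Q < M\<close>] by (auto simp: D_def)
  define w' where "w' = sqrt (\<alpha> / t) *\<^sub>R w"
  define \<beta>' where "\<beta>' i = (if i \<in> S then 1 else 0 :: real)" for i
  \<comment> \<open>on \<open>S\<close> the SDP constraint is at most \<open>c\<close>, elsewhere at most \<open>1\<close>; scaling by \<open>\<alpha>\<close> fits both\<close>
  have "Re (qform (H i) w') \<le> \<beta>' i * \<epsilon> + (1 - \<beta>' i)" if i: "i \<in> {1..M}" for i
  proof -
    have "Re (qform (H i) w') = \<alpha> / t * Re (qform (H i) w)"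
      using \<alpha> t by (simp add: w'_def qform_scaleR)
    also have "\<dots> \<le> \<alpha> * Re (ctrace (H i ** X))"
      using w_le[OF i] \<alpha> t by (simp add: field_simps)
    also have "\<dots> \<le> \<alpha> * (if i \<in> S then c else 1)"
    proof (intro mult_left_mono)
      have "0 \<le> \<beta> i"
        using bounds i by simp
      note bound = sdp_constraint_le[OF cons[rule_format, OF i] this \<epsilon>(2)]
      show "Re (ctrace (H i ** X)) \<le> (if i \<in> S then c else 1)"
        using bound(1) bound(2)[of D] S(3) by (simp add: c_def)
    qed (use \<alpha> in simp)
    finally show ?thesis
      using \<alpha> by (auto simp: \<beta>'_def)
  qed
  hence "qp_feasible M Q \<epsilon> H w' \<beta>'"
    using S sum_indicator_atLeastAtMost[OF S(1)] by (auto simp: qp_feasible_def \<beta>'_def)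
  moreover have "(norm w')\<^sup>2 = \<epsilon> / c / t * Re (ctrace X)"
  proof -
    have "(sqrt (\<alpha> / t))\<^sup>2 = \<alpha> / t"
      using \<alpha> t by simp
    thus ?thesis
      by (simp add: w'_def power_mult_distrib w \<alpha>_def)
  qed
  ultimately show ?thesis
    by (auto simp: c_def D_def t_def)
qed

theorem theorem3p4:
  fixes H :: "nat \<Rightarrow> complex^'n^'n"
    and M Q :: nat and \<epsilon> :: real
  assumes "CARD('n) \<ge> 2" and "M \<ge> 2"
    and "1 \<le> Q" and "Q \<le> M - 1"
    and "0 < \<epsilon>" and "\<epsilon> < 1"
    and "\<forall>i\<in>{1..M}. psd_mat (H i)"
  shows "v_QP M Q \<epsilon> H \<ge>
    ereal ((\<epsilon> / (1 - (1 - \<epsilon>) / (real M - real Q + 1))) *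
           (1 / (4 * ln (100 * (\<Sum>i=1..M. min (real (rank (H i))) (sqrt (real M)))))))
    * v_SDP M Q \<epsilon> H"
proof -
  define K where "K = (\<Sum>i=1..M. min (real (rank (H i))) (sqrt (real M)))"
  define c where "c = \<epsilon> / (1 - (1 - \<epsilon>) / (real M - real Q + 1)) / (4 * ln (100 * K))"
  have "Q < M"
    using assms(3,4) by linarith
  have card_le: "real (card {i\<in>{1..M}. H i \<noteq> 0}) \<le> K"
    unfolding K_def using assms(2) by (intro card_nonzero_le_sum_min_rank) simp
  have K: "K = 0 \<or> 1 \<le> K"
    unfolding K_def by (rule sum_min_rank_eq_0_or_ge_1) (use assms(2) in simp)
  \<comment> \<open>for \<open>K = 0\<close> the junk values \<open>ln 0 = 0\<close> and \<open>x / 0 = 0\<close> make \<open>c = 0\<close>\<close>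
  have "0 \<le> c"
    using K eps_le_c_tilde[OF \<open>Q < M\<close> assms(6)] assms(5) by (auto simp: c_def)
  moreover have "\<exists>w \<beta>'. qp_feasible M Q \<epsilon> H w \<beta>' \<and> (norm w)\<^sup>2 = c * Re (ctrace X)"
    if "sdp_feasible M Q \<epsilon> H X \<beta>" for X \<beta>
    using K qp_feasible_zero[of Q M \<epsilon> H] \<open>Q < M\<close> assms(5)
      sdp_feasible_rounding[OF assms(7) \<open>Q < M\<close> assms(5,6) card_le _ that]
    by (auto simp: c_def)
  ultimately have "ereal c * v_SDP M Q \<epsilon> H \<le> v_QP M Q \<epsilon> H"
    using \<open>Q < M\<close> assms(5) by (intro scaled_v_SDP_le_v_QP) auto
  thus ?thesis
    by (simp add: c_def K_def)
qed

end
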